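(* Let $m$ and $n$ be positive even integers. Then the rooks graph $K_m\,\Box\,K_n$ satisfies \[ D(K_m\,\Box\,K_n,2)=\frac m2+\frac n2-2 . \]
   Context: Graphs are finite and simple. For a graph $G$ and a positive integer $k$, a (fractional) $k$-coloring of $G$ is an assignment to every vertex $v$ of real numbers $f_1(v),\dots,f_k(v)\ge 0$ with $\sum_{j=1}^k f_j(v)=1$ ($f_j(v)$ is the usage of color $j$ at $v$). The defect of $v$ is $\mathrm{df}(v)=\sum_{w\in N(v)}\sum_{j=1}^k\min(f_j(v),f_j(w))$, where $N(v)$ is the set of neighbors of $v$. The defect of the coloring is $\max_v \mathrm{df}(v)$, and the minimum defect $D(G,k)$ is the minimum of this quantity over all $k$-colorings of $G$. $G\,\Box\,H$ denotes the Cartesian product: its vertex set is $V(G)\times V(H)$, and $(u_1,u_2)$, $(v_1,v_2)$ are adjacent if $u_1v_1\in E(G)$ and $u_2=v_2$, or $u_1=v_1$ and $u_2v_2\in E(H)$. The rooks graph is $K_m\,\Box\,K_n$, where $K_s$ is the complete graph on $s$ vertices. *)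

theory Defs
  imports Complex_Main "Graph_Theory.Kuratowski"
begin

text \<open>
  A finite simple graph is a \<^locale>\<open>pair_graph\<close>: finite vertex set, no loops, and an edge
  \<open>uv\<close> represented by the two arcs \<open>(u, v)\<close> and \<open>(v, u)\<close>.
\<close>

definition neighbors :: "'a pair_pre_digraph \<Rightarrow> 'a \<Rightarrow> 'a set" where
  "neighbors G v = {w. (v, w) \<in> parcs G}"

definition cartesian_product ::
    "'a pair_pre_digraph \<Rightarrow> 'b pair_pre_digraph \<Rightarrow> ('a \<times> 'b) pair_pre_digraph"
    (infixr \<open>\<box>\<close> 80) where
  "G \<box> H = \<lparr> pverts = pverts G \<times> pverts H,
     parcs = {((u1, u2), (v1, v2)) | u1 u2 v1 v2.
        (u1, u2) \<in> pverts G \<times> pverts H \<and> (v1, v2) \<in> pverts G \<times> pverts H \<and>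
        ((u1, v1) \<in> parcs G \<and> u2 = v2 \<or> u1 = v1 \<and> (u2, v2) \<in> parcs H)} \<rparr>"

lemma pair_graph_cartesian_product:
  assumes "pair_graph G" "pair_graph H"
  shows "pair_graph (G \<box> H)"
proof -
  interpret G: pair_graph G by fact
  interpret H: pair_graph H by fact
  have "finite (pverts (G \<box> H))"
    by (simp add: cartesian_product_def G.pair_finite_verts H.pair_finite_verts)
  moreover have "parcs (G \<box> H) \<subseteq> pverts (G \<box> H) \<times> pverts (G \<box> H)"
    by (auto simp: cartesian_product_def)
  ultimately have "finite (parcs (G \<box> H))"
    using finite_subset by blast
  then show ?thesis
    using \<open>finite (pverts (G \<box> H))\<close> G.arcs_symmetric H.arcs_symmetric
      G.pair_no_loops H.pair_no_loops
    by unfold_locales (auto simp: cartesian_product_def symmetric_def sym_def)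
qed

text \<open>
  \<open>f v j\<close> is the usage of color \<open>j\<close> at \<open>v\<close>, with colors \<open>1, \<dots>, k\<close>.
  Values outside the vertex set and the color set are irrelevant.
\<close>

definition frac_coloring :: "'a pair_pre_digraph \<Rightarrow> nat \<Rightarrow> ('a \<Rightarrow> nat \<Rightarrow> real) \<Rightarrow> bool" where
  "frac_coloring G k f \<longleftrightarrow>
     (\<forall>v \<in> pverts G. (\<forall>j \<in> {1..k}. 0 \<le> f v j) \<and> (\<Sum>j = 1..k. f v j) = 1)"

definition vertex_defect ::
    "'a pair_pre_digraph \<Rightarrow> nat \<Rightarrow> ('a \<Rightarrow> nat \<Rightarrow> real) \<Rightarrow> 'a \<Rightarrow> real" where
  "vertex_defect G k f v = (\<Sum>w \<in> neighbors G v. \<Sum>j = 1..k. min (f v j) (f w j))"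

text \<open>Meaningful for graphs with at least one vertex.\<close>

definition defect :: "'a pair_pre_digraph \<Rightarrow> nat \<Rightarrow> ('a \<Rightarrow> nat \<Rightarrow> real) \<Rightarrow> real" where
  "defect G k f = Max (vertex_defect G k f ` pverts G)"

text \<open>
  The minimum over all colorings, not just an infimum: \<open>LEAST\<close> denotes an attained value.
  By compactness it exists for every nonempty finite graph and \<open>k \<ge> 1\<close>.
\<close>

definition min_defect :: "'a pair_pre_digraph \<Rightarrow> nat \<Rightarrow> real" where
  "min_defect G k = (LEAST d. \<exists>f. frac_coloring G k f \<and> d = defect G k f)"

end

theory Submission
  imports Defs "HOL-Analysis.Convex"
begin

text \<open>
  Call \<open>\<Sum>j. min (f a j) (f b j)\<close> the overlap of the vertices \<open>a\<close> and \<open>b\<close>. A vertex overlaps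
  itself by \<open>1\<close>, so in a product of two complete graphs the defect of a vertex is the sum of its
  overlaps with its whole column and its whole row (itself included in both), minus \<open>2\<close>.

  The lower bound is an averaging argument, valid for every number \<open>k\<close> of colors. Since usages lie
  in \<open>[0, 1]\<close>, \<open>min x y \<ge> x * y\<close>; hence the overlaps in a line of \<open>s\<close> vertices, summed over all
  ordered pairs, are at least \<open>\<Sum>j. (S j)\<^sup>2\<close>, where \<open>S j\<close> is the total usage of color \<open>j\<close> on the line.
  As the \<open>S j\<close> add up to \<open>s\<close>, the Cauchy--Schwarz inequality bounds this below by \<open>s\<^sup>2 / k\<close>
  (\<open>overlap_sum_ge\<close>). Adding this up over all lines, the average defect is at least
  \<open>m / k + n / k - 2\<close>, and the maximum is at least the average (\<open>defect_complete_product_ge\<close>).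

  For \<open>k = 2\<close> and even sides, a checkerboard attains this: halve both vertex sets and color
  \<open>(u, v)\<close> according to whether \<open>u\<close> and \<open>v\<close> lie in corresponding halves. Every vertex then agrees
  with exactly half of its column and half of its row.
\<close>

definition overlap :: "nat \<Rightarrow> ('a \<Rightarrow> nat \<Rightarrow> real) \<Rightarrow> 'a \<Rightarrow> 'a \<Rightarrow> real" where
  "overlap k f a b = (\<Sum>j = 1..k. min (f a j) (f b j))"

section \<open>Overlaps along a line\<close>

lemma frac_coloring_le_1:
  assumes "frac_coloring G k f" "v \<in> pverts G" "j \<in> {1..k}"
  shows "f v j \<le> 1"
proof -
  have "f v j \<le> (\<Sum>j = 1..k. f v j)"
    using assms by (intro member_le_sum) (auto simp: frac_coloring_def)
  then show ?thesis
    using assms by (simp add: frac_coloring_def)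
qed

lemma overlap_self:
  assumes "frac_coloring G k f" "v \<in> pverts G"
  shows "overlap k f v v = 1"
  using assms by (simp add: overlap_def frac_coloring_def)

text \<open>
  Bounding the minimum by the product makes the double sum factor into squares of the total color
  usages, to which the Cauchy--Schwarz inequality applies.
\<close>

lemma overlap_sum_ge:
  assumes f: "frac_coloring G k f" and A: "A \<subseteq> pverts G"
  shows "(real (card A))\<^sup>2 / real k \<le> (\<Sum>a\<in>A. \<Sum>b\<in>A. overlap k f a b)"
proof -
  have "(real (card A))\<^sup>2 = (\<Sum>a\<in>A. \<Sum>j = 1..k. f a j)\<^sup>2"
    using f A by (simp add: frac_coloring_def subset_iff)
  also have "\<dots> = (\<Sum>j = 1..k. \<Sum>a\<in>A. f a j)\<^sup>2"
    by (subst sum.swap) simp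
  also have "\<dots> \<le> real k * (\<Sum>j = 1..k. (\<Sum>a\<in>A. f a j)\<^sup>2)"
    using sum_squared_le_sum_of_squares[of "\<lambda>j. \<Sum>a\<in>A. f a j" "{1..k}"]
    by (simp add: mult.commute)
  finally have "(real (card A))\<^sup>2 / real k \<le> (\<Sum>j = 1..k. (\<Sum>a\<in>A. f a j)\<^sup>2)"
    by (cases "k = 0") (simp_all add: field_simps)
  also have "\<dots> = (\<Sum>j = 1..k. \<Sum>a\<in>A. \<Sum>b\<in>A. f a j * f b j)"
    by (simp add: power2_eq_square sum_product)
  also have "\<dots> = (\<Sum>a\<in>A. \<Sum>j = 1..k. \<Sum>b\<in>A. f a j * f b j)"
    by (rule sum.swap)
  also have "\<dots> = (\<Sum>a\<in>A. \<Sum>b\<in>A. \<Sum>j = 1..k. f a j * f b j)"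
    by (intro sum.cong refl sum.swap)
  also have "\<dots> \<le> (\<Sum>a\<in>A. \<Sum>b\<in>A. overlap k f a b)"
    unfolding overlap_def
  proof (intro sum_mono)
    fix a b j
    assume *: "a \<in> A" "b \<in> A" "j \<in> {1..k}"
    then have "0 \<le> f a j" "0 \<le> f b j"
      using f A by (auto simp: frac_coloring_def)
    moreover have "f a j \<le> 1" "f b j \<le> 1"
      using frac_coloring_le_1[OF f] * A by auto
    ultimately show "f a j * f b j \<le> min (f a j) (f b j)"
      by (simp add: mult_left_le mult_left_le_one_le)
  qed
  finally show ?thesis .
qed

section \<open>Defects in products of complete graphs\<close>

lemma complete_pair_graphD:
  assumes "K\<^bsub>n\<^esub> (with_proj G)"
  shows "finite (pverts G)" "card (pverts G) = n"
    "(u, v) \<in> parcs G \<longleftrightarrow> u \<in> pverts G \<and> v \<in> pverts G \<and> u \<noteq> v"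
  using assms by (auto simp: complete_digraph_pair_def)

lemma pverts_cartesian_product: "pverts (G \<box> H) = pverts G \<times> pverts H"
  by (simp add: cartesian_product_def)

lemma neighbors_complete_product:
  assumes G: "K\<^bsub>m\<^esub> (with_proj G)" and H: "K\<^bsub>n\<^esub> (with_proj H)"
    and "u \<in> pverts G" "v \<in> pverts H"
  shows "neighbors (G \<box> H) (u, v) =
    (\<lambda>u'. (u', v)) ` (pverts G - {u}) \<union> (\<lambda>v'. (u, v')) ` (pverts H - {v})"
  using assms(3,4)
  by (auto simp: neighbors_def cartesian_product_def complete_pair_graphD(3)[OF G]
      complete_pair_graphD(3)[OF H])

text \<open>
  Counting the vertex itself once in its column and once in its row makes both sums range over
  full lines, as in the double sums of \<open>overlap_sum_ge\<close>.
\<close>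

lemma vertex_defect_complete_product:
  assumes G: "K\<^bsub>m\<^esub> (with_proj G)" and H: "K\<^bsub>n\<^esub> (with_proj H)"
    and f: "frac_coloring (G \<box> H) k f" and u: "u \<in> pverts G" and v: "v \<in> pverts H"
  shows "vertex_defect (G \<box> H) k f (u, v) =
    (\<Sum>u'\<in>pverts G. overlap k f (u, v) (u', v)) +
    (\<Sum>v'\<in>pverts H. overlap k f (u, v) (u, v')) - 2"
proof -
  note fin = complete_pair_graphD(1)[OF G] complete_pair_graphD(1)[OF H]
  have self: "overlap k f (u, v) (u, v) = 1"
    using f u v by (intro overlap_self) (auto simp: pverts_cartesian_product)
  have "vertex_defect (G \<box> H) k f (u, v) =
    (\<Sum>w \<in> (\<lambda>u'. (u', v)) ` (pverts G - {u}). overlap k f (u, v) w) +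
    (\<Sum>w \<in> (\<lambda>v'. (u, v')) ` (pverts H - {v}). overlap k f (u, v) w)"
    unfolding vertex_defect_def overlap_def neighbors_complete_product[OF G H u v]
    by (intro sum.union_disjoint) (auto simp: fin)
  also have "\<dots> = (\<Sum>u' \<in> pverts G - {u}. overlap k f (u, v) (u', v)) +
    (\<Sum>v' \<in> pverts H - {v}. overlap k f (u, v) (u, v'))"
    by (simp add: sum.reindex inj_on_def)
  also have "\<dots> = (\<Sum>u'\<in>pverts G. overlap k f (u, v) (u', v)) +
    (\<Sum>v'\<in>pverts H. overlap k f (u, v) (u, v')) - 2"
    by (simp add: sum_diff1 fin u v self)
  finally show ?thesis .
qed

theorem defect_complete_product_ge:
  assumes G: "K\<^bsub>m\<^esub> (with_proj G)" and H: "K\<^bsub>n\<^esub> (with_proj H)"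
    and "0 < m" "0 < n" and f: "frac_coloring (G \<box> H) k f"
  shows "real m / real k + real n / real k - 2 \<le> defect (G \<box> H) k f"
proof -
  let ?V = "pverts G" and ?W = "pverts H"
  let ?d = "vertex_defect (G \<box> H) k f"
  note fin = complete_pair_graphD(1)[OF G] complete_pair_graphD(1)[OF H]
  note card = complete_pair_graphD(2)[OF G] complete_pair_graphD(2)[OF H]
  have col: "(real m)\<^sup>2 / real k \<le> (\<Sum>u\<in>?V. \<Sum>u'\<in>?V. overlap k f (u, v) (u', v))"
    if "v \<in> ?W" for v
  proof -
    have inj: "inj_on (\<lambda>u. (u, v)) ?V"
      by (simp add: inj_on_def)
    show ?thesis
      using overlap_sum_ge[OF f, of "(\<lambda>u. (u, v)) ` ?V"] that inj
      by (simp add: pverts_cartesian_product image_subset_iff sum.reindex card_image card)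
  qed
  have row: "(real n)\<^sup>2 / real k \<le> (\<Sum>v\<in>?W. \<Sum>v'\<in>?W. overlap k f (u, v) (u, v'))"
    if "u \<in> ?V" for u
  proof -
    have inj: "inj_on (\<lambda>v. (u, v)) ?W"
      by (simp add: inj_on_def)
    show ?thesis
      using overlap_sum_ge[OF f, of "(\<lambda>v. (u, v)) ` ?W"] that inj
      by (simp add: pverts_cartesian_product image_subset_iff sum.reindex card_image card)
  qed
  have "real m * real n * (real m / real k + real n / real k - 2) =
      (\<Sum>v\<in>?W. (real m)\<^sup>2 / real k) + (\<Sum>u\<in>?V. (real n)\<^sup>2 / real k) - 2 * real m * real n"
    by (simp add: card power2_eq_square algebra_simps)
  also have "\<dots> \<le> (\<Sum>v\<in>?W. \<Sum>u\<in>?V. \<Sum>u'\<in>?V. overlap k f (u, v) (u', v)) +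
      (\<Sum>u\<in>?V. \<Sum>v\<in>?W. \<Sum>v'\<in>?W. overlap k f (u, v) (u, v')) - 2 * real m * real n"
    by (intro diff_right_mono add_mono sum_mono col row)
  also have "\<dots> = (\<Sum>u\<in>?V. \<Sum>v\<in>?W. ?d (u, v))"
    by (subst sum.swap)
      (simp add: vertex_defect_complete_product[OF G H f] sum.distrib sum_subtractf card)
  also have "\<dots> \<le> (\<Sum>u\<in>?V. \<Sum>v\<in>?W. defect (G \<box> H) k f)"
    unfolding defect_def
    by (intro sum_mono Max_ge) (auto simp: pverts_cartesian_product fin)
  also have "\<dots> = real m * real n * defect (G \<box> H) k f"
    by (simp add: card)
  finally show ?thesis
    using \<open>0 < m\<close> \<open>0 < n\<close> by (simp add: mult_le_cancel_left)
qed

section \<open>The checkerboard coloring\<close>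

definition checkerboard :: "'a set \<Rightarrow> 'b set \<Rightarrow> 'a \<times> 'b \<Rightarrow> nat \<Rightarrow> real" where
  "checkerboard A B w j = of_bool ((j = 1) \<longleftrightarrow> ((fst w \<in> A) \<longleftrightarrow> (snd w \<in> B)))"

lemma frac_coloring_checkerboard: "frac_coloring G 2 (checkerboard A B)"
  by (auto simp: frac_coloring_def checkerboard_def numeral_2_eq_2)

lemma overlap_checkerboard:
  "overlap 2 (checkerboard A B) (u, v) (u', v') =
    of_bool (((u \<in> A) \<longleftrightarrow> (v \<in> B)) \<longleftrightarrow> ((u' \<in> A) \<longleftrightarrow> (v' \<in> B)))"
  by (auto simp: overlap_def checkerboard_def numeral_2_eq_2)

lemma card_same_half:
  assumes "finite V" "A \<subseteq> V" "2 * card A = card V"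
  shows "real (card {x \<in> V. P \<longleftrightarrow> x \<in> A}) = real (card V) / 2"
proof -
  have "card {x \<in> V. P \<longleftrightarrow> x \<in> A} = card A"
  proof (cases P)
    case True
    then have "{x \<in> V. P \<longleftrightarrow> x \<in> A} = A"
      using assms by auto
    then show ?thesis by simp
  next
    case False
    then have "{x \<in> V. P \<longleftrightarrow> x \<in> A} = V - A"
      by auto
    then show ?thesis
      using assms by (simp add: card_Diff_subset finite_subset)
  qed
  then show ?thesis
    by (simp flip: assms(3))
qed

lemma vertex_defect_checkerboard:
  assumes G: "K\<^bsub>m\<^esub> (with_proj G)" and H: "K\<^bsub>n\<^esub> (with_proj H)"
    and A: "A \<subseteq> pverts G" "2 * card A = m" and B: "B \<subseteq> pverts H" "2 * card B = n"
    and u: "u \<in> pverts G" and v: "v \<in> pverts H"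
  shows "vertex_defect (G \<box> H) 2 (checkerboard A B) (u, v) = real m / 2 + real n / 2 - 2"
proof -
  note fin = complete_pair_graphD(1)[OF G] complete_pair_graphD(1)[OF H]
  note card = complete_pair_graphD(2)[OF G] complete_pair_graphD(2)[OF H]
  have "(\<Sum>u'\<in>pverts G. overlap 2 (checkerboard A B) (u, v) (u', v)) =
      real (card {u' \<in> pverts G. u \<in> A \<longleftrightarrow> u' \<in> A})"
    unfolding overlap_checkerboard using fin
    by (auto simp: of_bool_def sum.If_cases intro!: arg_cong[where f = card])
  moreover have "(\<Sum>v'\<in>pverts H. overlap 2 (checkerboard A B) (u, v) (u, v')) =
      real (card {v' \<in> pverts H. v \<in> B \<longleftrightarrow> v' \<in> B})"
    unfolding overlap_checkerboard using fin
    by (auto simp: of_bool_def sum.If_cases intro!: arg_cong[where f = card])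
  ultimately show ?thesis
    using vertex_defect_complete_product[OF G H frac_coloring_checkerboard u v, of A B]
      card_same_half[OF fin(1) A(1), of "u \<in> A"] card_same_half[OF fin(2) B(1), of "v \<in> B"]
      A(2) B(2) card by simp
qed

theorem corollary2:
  fixes m n :: nat
    and G :: "'a pair_pre_digraph" and H :: "'b pair_pre_digraph"
  assumes "0 < m" "even m" "0 < n" "even n"
    and "K\<^bsub>m\<^esub> (with_proj G)" "K\<^bsub>n\<^esub> (with_proj H)"
  shows "min_defect (G \<box> H) 2 = real m / 2 + real n / 2 - 2"
proof -
  note G = \<open>K\<^bsub>m\<^esub> (with_proj G)\<close> and H = \<open>K\<^bsub>n\<^esub> (with_proj H)\<close>
  note card = complete_pair_graphD(2)[OF G] complete_pair_graphD(2)[OF H]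
  obtain A where A: "A \<subseteq> pverts G" "card A = m div 2"
    using obtain_subset_with_card_n[of "m div 2" "pverts G"] card by auto
  obtain B where B: "B \<subseteq> pverts H" "card B = n div 2"
    using obtain_subset_with_card_n[of "n div 2" "pverts H"] card by auto
  have "pverts G \<noteq> {}" "pverts H \<noteq> {}"
    using card \<open>0 < m\<close> \<open>0 < n\<close> by auto
  moreover have "vertex_defect (G \<box> H) 2 (checkerboard A B) w = real m / 2 + real n / 2 - 2"
    if "w \<in> pverts (G \<box> H)" for w
    using that vertex_defect_checkerboard[OF G H A(1) _ B(1)] A(2) B(2) \<open>even m\<close> \<open>even n\<close>
    by (auto simp: pverts_cartesian_product)
  ultimately have "vertex_defect (G \<box> H) 2 (checkerboard A B) ` pverts (G \<box> H) =
      {real m / 2 + real n / 2 - 2}"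
    by (auto simp: pverts_cartesian_product image_constant_conv cong: image_cong)
  then have attained: "defect (G \<box> H) 2 (checkerboard A B) = real m / 2 + real n / 2 - 2"
    by (simp add: defect_def)
  show ?thesis
    unfolding min_defect_def
  proof (rule Least_equality)
    show "\<exists>f. frac_coloring (G \<box> H) 2 f \<and> real m / 2 + real n / 2 - 2 = defect (G \<box> H) 2 f"
      using attained frac_coloring_checkerboard by metis
  next
    fix d
    assume "\<exists>f. frac_coloring (G \<box> H) 2 f \<and> d = defect (G \<box> H) 2 f"
    then show "real m / 2 + real n / 2 - 2 \<le> d"
      using defect_complete_product_ge[OF G H \<open>0 < m\<close> \<open>0 < n\<close>, of 2] by auto
  qed
qed

end
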